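(* Let $E$ and $F$ be equivalence relations on sets $X$ and $Y$, respectively. Then: \begin{enumerate} \item $E\leq F$ if and only if $|X/E|\leq |Y/F|$; \item $E\sqsubseteq F$ if and only if for every cardinal $\kappa$, $\mathrm{n}_{\geq\kappa}(E)\leq \mathrm{n}_{\geq\kappa}(F)$; \item if $E\preccurlyeq F$, then for every cardinal $\kappa$, $\mathrm{n}_{\leq\kappa}(E)\leq \mathrm{n}_{\leq\kappa}(F)$ and $\mathrm{n}_{\geq\kappa}(E)\geq \mathrm{n}_{\geq\kappa}(F)$; \item $E\cong F$ if and only if for every cardinal $\kappa$, $\mathrm{n}_{\kappa}(E)=\mathrm{n}_{\kappa}(F)$; \item if $E\leq^i F$, then for every cardinal $\kappa$, $\mathrm{n}_{\leq\kappa}(E)\leq \mathrm{n}_{\leq\kappa}(F)$; \item $E\leq^f F$ if and only if $|X/E|=|Y/F|$; \item $E\sqsubseteq^i F$ if and only if for every cardinal $\kappa$, $\mathrm{n}_{\kappa}(E)\leq \mathrm{n}_{\kappa}(F)$; \item $E\sqsubseteq^f F$ if and only if $F\preccurlyeq E$. \end{enumerate}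
   Context: No definability assumptions are made; everything is purely set-theoretic (ZFC). For equivalence relations $E$ on $X$ and $F$ on $Y$, a homomorphism from $E$ to $F$ is a function $\phi:X\to Y$ such that $x\mathrel{E}x'$ implies $\phi(x)\mathrel{F}\phi(x')$; it induces $\tilde\phi:X/E\to Y/F$, $\tilde\phi([x]_E)=[\phi(x)]_F$. Consider the properties: (i) $\phi$ is one-to-one; (ii) $\phi$ is onto; (iii) $\tilde\phi$ is one-to-one; (iv) $\tilde\phi$ is onto; (v) $\mathrm{ran}(\phi)$ is $F$-invariant (if $y\in\mathrm{ran}(\phi)$ and $y\mathrel{F}y'$ then $y'\in\mathrm{ran}(\phi)$). A homomorphism $\phi$ is: a reduction if (iii); an embedding if (i),(iii); a surjective reduction if (ii)–(v); an isomorphism if (i)–(v); an invariant reduction if (iii),(v); a full reduction if (iii),(iv); an invariant embedding if (i),(iii),(v); a full embedding if (i),(iii),(iv). We write $E\leq F$, $E\sqsubseteq F$, $E\preccurlyeq F$, $E\cong F$, $E\leq^i F$, $E\leq^f F$, $E\sqsubseteq^i F$, $E\sqsubseteq^f F$ respectively if there exists a reduction, embedding, surjective reduction, isomorphism, invariant reduction, full reduction, invariant embedding, full embedding from $E$ to $F$. For a (possibly finite) cardinal $\kappa$, $\mathrm{n}_\kappa(E)$ is the number of $E$-classes of cardinality exactly $\kappa$, $\mathrm{n}_{\geq\kappa}(E)$ the number of $E$-classes of cardinality at least $\kappa$, and $\mathrm{n}_{\leq\kappa}(E)$ the number of $E$-classes of cardinality at most $\kappa$. *)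

theory Defs
  imports Main
begin

unbundle cardinal_syntax

definition homomorphism :: "'a set \<Rightarrow> 'a rel \<Rightarrow> 'b set \<Rightarrow> 'b rel \<Rightarrow> ('a \<Rightarrow> 'b) \<Rightarrow> bool" where
  "homomorphism X E Y F \<phi> \<longleftrightarrow>
     \<phi> ` X \<subseteq> Y \<and> (\<forall>x\<in>X. \<forall>x'\<in>X. (x, x') \<in> E \<longrightarrow> (\<phi> x, \<phi> x') \<in> F)"

text \<open>The map between the quotients sends a class \<open>C\<close> to the \<open>F\<close>-saturation of its image,
  which is the \<open>F\<close>-class of the image of any representative.\<close>

definition induced_map :: "'b rel \<Rightarrow> ('a \<Rightarrow> 'b) \<Rightarrow> 'a set \<Rightarrow> 'b set" where
  "induced_map F \<phi> C = F `` (\<phi> ` C)"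

lemma induced_map_class:
  assumes "equiv X E" "equiv Y F" "homomorphism X E Y F \<phi>" "x \<in> X"
  shows "induced_map F \<phi> (E `` {x}) = F `` {\<phi> x}"
proof -
  have "(\<phi> x, \<phi> x') \<in> F" if "x' \<in> E `` {x}" for x'
    using assms that unfolding homomorphism_def equiv_def by blast
  moreover have "x \<in> E `` {x}"
    using assms(1,4) by (rule equiv_class_self)
  moreover have "trans F"
    using assms(2) by (simp add: equiv_def)
  ultimately show ?thesis
    unfolding induced_map_def by (blast dest: transD)
qed

definition invariant :: "'b rel \<Rightarrow> 'b set \<Rightarrow> bool" where
  "invariant F B \<longleftrightarrow> (\<forall>y y'. y \<in> B \<and> (y, y') \<in> F \<longrightarrow> y' \<in> B)"

definition is_reduction where
  "is_reduction X E Y F \<phi> \<longleftrightarrow>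
     homomorphism X E Y F \<phi> \<and> inj_on (induced_map F \<phi>) (X // E)"

definition is_embedding where
  "is_embedding X E Y F \<phi> \<longleftrightarrow>
     homomorphism X E Y F \<phi> \<and> inj_on \<phi> X \<and> inj_on (induced_map F \<phi>) (X // E)"

definition is_surjective_reduction where
  "is_surjective_reduction X E Y F \<phi> \<longleftrightarrow>
     homomorphism X E Y F \<phi> \<and> \<phi> ` X = Y \<and>
     inj_on (induced_map F \<phi>) (X // E) \<and> induced_map F \<phi> ` (X // E) = Y // F \<and>
     invariant F (\<phi> ` X)"

definition is_isomorphism where
  "is_isomorphism X E Y F \<phi> \<longleftrightarrow>
     homomorphism X E Y F \<phi> \<and> inj_on \<phi> X \<and> \<phi> ` X = Y \<and>
     inj_on (induced_map F \<phi>) (X // E) \<and> induced_map F \<phi> ` (X // E) = Y // F \<and>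
     invariant F (\<phi> ` X)"

definition is_invariant_reduction where
  "is_invariant_reduction X E Y F \<phi> \<longleftrightarrow>
     homomorphism X E Y F \<phi> \<and> inj_on (induced_map F \<phi>) (X // E) \<and> invariant F (\<phi> ` X)"

definition is_full_reduction where
  "is_full_reduction X E Y F \<phi> \<longleftrightarrow>
     homomorphism X E Y F \<phi> \<and>
     inj_on (induced_map F \<phi>) (X // E) \<and> induced_map F \<phi> ` (X // E) = Y // F"

definition is_invariant_embedding where
  "is_invariant_embedding X E Y F \<phi> \<longleftrightarrow>
     homomorphism X E Y F \<phi> \<and> inj_on \<phi> X \<and>
     inj_on (induced_map F \<phi>) (X // E) \<and> invariant F (\<phi> ` X)"

definition is_full_embedding where
  "is_full_embedding X E Y F \<phi> \<longleftrightarrow>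
     homomorphism X E Y F \<phi> \<and> inj_on \<phi> X \<and>
     inj_on (induced_map F \<phi>) (X // E) \<and> induced_map F \<phi> ` (X // E) = Y // F"

definition reducible where
  "reducible X E Y F \<longleftrightarrow> (\<exists>\<phi>. is_reduction X E Y F \<phi>)"

definition embeddable where
  "embeddable X E Y F \<longleftrightarrow> (\<exists>\<phi>. is_embedding X E Y F \<phi>)"

definition surjectively_reducible where
  "surjectively_reducible X E Y F \<longleftrightarrow> (\<exists>\<phi>. is_surjective_reduction X E Y F \<phi>)"

definition isomorphic where
  "isomorphic X E Y F \<longleftrightarrow> (\<exists>\<phi>. is_isomorphism X E Y F \<phi>)"

definition invariantly_reducible where
  "invariantly_reducible X E Y F \<longleftrightarrow> (\<exists>\<phi>. is_invariant_reduction X E Y F \<phi>)"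

definition fully_reducible where
  "fully_reducible X E Y F \<longleftrightarrow> (\<exists>\<phi>. is_full_reduction X E Y F \<phi>)"

definition invariantly_embeddable where
  "invariantly_embeddable X E Y F \<longleftrightarrow> (\<exists>\<phi>. is_invariant_embedding X E Y F \<phi>)"

definition fully_embeddable where
  "fully_embeddable X E Y F \<longleftrightarrow> (\<exists>\<phi>. is_full_embedding X E Y F \<phi>)"

text \<open>The numbers of classes are cardinals, that is, cardinal orders up to \<open>=o\<close>. A cardinal
  \<open>\<kappa>\<close> is any \<open>\<kappa>\<close> with \<open>Card_order \<kappa>\<close>, so finite cardinals and zero are included. The base type
  of \<open>\<kappa>\<close> is unrelated to that of \<open>X\<close>, since \<open>=o\<close> and \<open>\<le>o\<close> compare orders across types.

  A quantifier over all cardinals has to range over the cardinal orders on some type, and that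
  type must be large enough. The type \<open>'k + 'a + 'b\<close>, with \<open>'k\<close> a free type variable, contains a
  copy of every subset of \<open>X\<close> and of \<open>Y\<close>, hence every possible class size; and any cardinal
  order on any type occurs, up to \<open>=o\<close>, once that type is taken for \<open>'k\<close>.\<close>

definition n_eq :: "'k rel \<Rightarrow> 'a set \<Rightarrow> 'a rel \<Rightarrow> 'a set rel" where
  "n_eq \<kappa> X E = |{C \<in> X // E. |C| =o \<kappa>}|"

definition n_ge :: "'k rel \<Rightarrow> 'a set \<Rightarrow> 'a rel \<Rightarrow> 'a set rel" where
  "n_ge \<kappa> X E = |{C \<in> X // E. \<kappa> \<le>o |C| }|"

definition n_le :: "'k rel \<Rightarrow> 'a set \<Rightarrow> 'a rel \<Rightarrow> 'a set rel" where
  "n_le \<kappa> X E = |{C \<in> X // E. |C| \<le>o \<kappa>}|"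

end

(* A homomorphism is determined by a map f between the sets of classes together with maps
   C \<rightarrow> f C, so every notion of reducibility asks for a map f between classes (injective or
   bijective) with a comparison of |C| and |f C|.  The only delicate part is 2, which needs an
   injective f with |C| \<le> |f C|.  Writing \<nu>(C) for the number of classes of E at least as large
   as C, order the classes of E first by \<nu>, then within a level of \<nu> by a well-order of minimal
   type.  Sizes are well-ordered, so a set of classes has a smallest member C and hence at most
   \<nu>(C) elements.  It follows that every C has fewer than \<nu>(C) predecessors: for infinite \<nu>(C) by
   applying this to the earlier levels and to the level of C, for finite \<nu>(C) because every
   predecessor is at least as large as C.  As there are at least \<nu>(C) classes of F large enough
   for C, f can be chosen injectively by well-founded recursion. *)

theory Submission
  imports Defs
begin

section \<open>Injective choice along a well-founded order\<close>

text \<open>Greedy transfinite choice: the values taken at the predecessors of \<open>s\<close>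
  cannot exhaust \<open>R s\<close>, so a fresh one remains. Totality ensures that of two distinct
  elements one was chosen to avoid the value of the other.\<close>

lemma injective_selector:
  fixes r :: "'a rel" and R :: "'a \<Rightarrow> 'b set"
  assumes wf: "wf r"
    and total: "\<And>s t. s \<in> S \<Longrightarrow> t \<in> S \<Longrightarrow> s \<noteq> t \<Longrightarrow> (s, t) \<in> r \<or> (t, s) \<in> r"
    and few: "\<And>s. s \<in> S \<Longrightarrow> |{t \<in> S. (t, s) \<in> r}| <o |R s|"
  obtains f where "inj_on f S" "\<And>s. s \<in> S \<Longrightarrow> f s \<in> R s"
proof -
  define P where "P = (\<lambda>s. {t \<in> S. (t, s) \<in> r})"
  define f where "f = wfrec r (\<lambda>f s. SOME y. y \<in> R s - f ` P s)"
  have unfold: "f s = (SOME y. y \<in> R s - f ` P s)" for s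
  proof -
    \<comment> \<open>Inside the recursion the function is available only as
      \<open>cut f r s\<close>, which agrees with \<open>f\<close> on the predecessors in
      \<open>P s\<close>.\<close>
    have "cut f r s ` P s = f ` P s"
      by (rule image_cong) (auto simp: P_def cut_def)
    moreover have "f s = (SOME y. y \<in> R s - cut f r s ` P s)"
      unfolding f_def by (rule wfrec[OF wf])
    ultimately show ?thesis
      by (simp only:)
  qed
  have choice: "f s \<in> R s - f ` P s" if "s \<in> S" for s
  proof -
    have "\<not> R s \<subseteq> f ` P s"
    proof
      assume "R s \<subseteq> f ` P s"
      then have "|R s| \<le>o |P s|"
        by (meson card_of_image card_of_mono1 ordLeq_transitive)
      then show False
        using few[OF that] by (simp add: P_def not_ordLess_ordLeq)
    qed
    then show ?thesis
      unfolding unfold[of s] by (metis (no_types, lifting) Diff_iff someI_ex subsetI)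
  qed
  have "inj_on f S"
  proof (rule inj_onI, rule ccontr)
    fix s t assume *: "s \<in> S" "t \<in> S" "f s = f t" "s \<noteq> t"
    then have "t \<in> P s \<or> s \<in> P t"
      using total by (auto simp: P_def)
    then show False
      using choice * by (metis Diff_iff imageI)
  qed
  with choice show thesis
    using that by auto
qed

section \<open>A well-founded order on weighted elements with few predecessors\<close>

context
  fixes S :: "'a set" and w :: "'a \<Rightarrow> 'b rel"
  assumes Card_order_weight: "\<And>s. Card_order (w s)"
begin

text \<open>When \<open>S\<close> is the set of classes of \<open>E\<close> and \<open>w\<close> is
  \<open>card_of\<close>, the cardinal \<open>|heavier s|\<close> is the count \<nu> by which
  elements are ranked.\<close>

definition heavier :: "'a \<Rightarrow> 'a set" where
  "heavier s = {t \<in> S. w s \<le>o w t}"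

definition level :: "'a \<Rightarrow> 'a set" where
  "level s = {t \<in> S. |heavier t| =o |heavier s|}"

text \<open>Lexicographic order. The cardinal \<open>|level s|\<close> serves as a concrete
  well-order of minimal type on the level, so its proper initial segments are smaller than the
  level; subtracting \<open>Id\<close> makes it strict.\<close>

definition level_order :: "'a rel" where
  "level_order = {(t, s). |heavier t| <o |heavier s| \<or>
     |heavier t| =o |heavier s| \<and> (t, s) \<in> |level s| - Id}"

text \<open>Cardinals are well-ordered, so some member of \<open>L\<close> has least weight. This
  bounds the size of a set by the \<nu> of one of its own members.\<close>

lemma subset_heavier:
  assumes "L \<subseteq> S" "L \<noteq> {}"
  obtains s where "s \<in> L" "L \<subseteq> heavier s"
proof -
  obtain s where s: "s \<in> L" "\<And>t. (t, s) \<in> inv_image ordLess w \<Longrightarrow> t \<notin> L"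
    using assms(2) wf_inv_image[OF wf_ordLess] by (metis ex_in_conv wfE_min)
  have "w s \<le>o w t" if "t \<in> L" for t
    using s(2)[of t] that Card_order_weight
    by (metis card_order_on_def in_inv_image not_ordLeq_iff_ordLess)
  then have "L \<subseteq> heavier s"
    using assms(1) by (auto simp: heavier_def)
  with s(1) show thesis
    by (rule that)
qed

lemma level_cong: "|heavier t| =o |heavier s| \<Longrightarrow> level t = level s"
  unfolding level_def by (meson ordIso_symmetric ordIso_transitive)

text \<open>Minimise in two stages: first \<open>|heavier z|\<close> over \<open>Q\<close>, by
  well-foundedness of \<open><o\<close>, then the position in \<open>|level z|\<close> among the
  members of \<open>Q\<close> with that same value. By \<open>level_cong\<close> the second stage
  uses one well-order throughout.\<close>

lemma wf_level_order: "wf level_order"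
proof (rule wfI_min)
  fix x :: 'a and Q :: "'a set" assume "x \<in> Q"
  then obtain z where z: "z \<in> Q" "\<And>t. |heavier t| <o |heavier z| \<Longrightarrow> t \<notin> Q"
    using wfE_min[OF wf_inv_image[OF wf_ordLess, of "\<lambda>s. |heavier s|"], of x Q]
    by (auto simp: in_inv_image)
  define Q' where "Q' = {q \<in> Q. |heavier q| =o |heavier z|}"
  have "z \<in> Q'"
    using z(1) card_of_refl by (auto simp: Q'_def)
  moreover have "wf ( |level z| - Id)"
    using card_of_well_order_on[of "level z"] by (simp add: well_order_on_def)
  ultimately obtain y where y: "y \<in> Q'" "\<And>t. (t, y) \<in> |level z| - Id \<Longrightarrow> t \<notin> Q'"
    by (metis wfE_min)
  have yz: "|heavier y| =o |heavier z|"
    using y(1) by (simp add: Q'_def)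
  have "t \<notin> Q" if "(t, y) \<in> level_order" for t
    using that unfolding level_order_def
  proof (elim CollectE case_prodE Pair_inject disjE conjE)
    fix t' s assume "|heavier t'| <o |heavier s|" "t = t'" "y = s"
    then show "t \<notin> Q"
      using z(2) yz ordLess_ordIso_trans by blast
  next
    fix t' s assume "|heavier t'| =o |heavier s|" "(t', s) \<in> |level s| - Id" "t = t'" "y = s"
    then show "t \<notin> Q"
      using y(2)[of t] level_cong[OF yz] yz ordIso_transitive by (auto simp: Q'_def)
  qed
  then show "\<exists>z\<in>Q. \<forall>y. (y, z) \<in> level_order \<longrightarrow> y \<notin> Q"
    using y(1) by (auto simp: Q'_def)
qed

lemma level_order_total:
  assumes "s \<in> S" "t \<in> S" "s \<noteq> t"
  shows "(s, t) \<in> level_order \<or> (t, s) \<in> level_order"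
proof (cases "|heavier s| =o |heavier t|")
  case True
  then have eq: "level s = level t" and True': "|heavier t| =o |heavier s|"
    using level_cong[OF True] ordIso_symmetric[OF True] by auto
  have "s \<in> level t" "t \<in> level t"
    using assms True card_of_refl by (auto simp: level_def)
  then have "(s, t) \<in> |level t| \<or> (t, s) \<in> |level t|"
    using card_of_well_order_on[of "level t"] assms(3)
    by (auto simp: well_order_on_def linear_order_on_def total_on_def)
  then show ?thesis
    using True True' eq assms(3) by (auto simp: level_order_def)
next
  case False
  then have "|heavier s| <o |heavier t| \<or> |heavier t| <o |heavier s|"
    by (metis card_of_Well_order not_ordLeq_iff_ordLess ordLeq_iff_ordLess_or_ordIso)
  then show ?thesis
    by (auto simp: level_order_def)
qed

lemma level_order_predecessors:
  assumes s: "s \<in> S"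
  shows "|{t \<in> S. (t, s) \<in> level_order}| <o |heavier s|"
proof (cases "finite (heavier s)")
  case True
  have "{t \<in> S. (t, s) \<in> level_order} \<subseteq> heavier s - {s}"
  proof
    fix t assume t: "t \<in> {t \<in> S. (t, s) \<in> level_order}"
    then have le: "|heavier t| \<le>o |heavier s|" and "t \<noteq> s"
      using ordLess_irreflexive by (auto simp: level_order_def ordLeq_iff_ordLess_or_ordIso)
    have "w s \<le>o w t"
    proof (rule ccontr)
      \<comment> \<open>A strictly lighter \<open>t\<close> would have in \<open>heavier t\<close>
        everything from \<open>heavier s\<close> and also \<open>t\<close> itself. For finite sets
        this proper inclusion contradicts \<open>le\<close>.\<close>
      assume *: "\<not> w s \<le>o w t"
      then have "w t \<le>o w s"
        by (metis Card_order_weight card_order_on_def ordLeq_total)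
      then have "heavier s \<subseteq> heavier t" "t \<in> heavier t" "t \<notin> heavier s"
        using t * ordLeq_transitive Card_order_weight
        by (auto simp: heavier_def card_order_on_def)
      moreover have "finite (heavier t)"
        using le True by (metis card_of_ordLeq_finite)
      ultimately have "card (heavier s) < card (heavier t)"
        by (intro psubset_card_mono) auto
      then show False
        using le True by (meson card_of_ordLeq card_inj_on_le linorder_not_less)
    qed
    then show "t \<in> heavier s - {s}"
      using t \<open>t \<noteq> s\<close> by (simp add: heavier_def)
  qed
  moreover have "s \<in> heavier s"
    using s Card_order_weight by (simp add: heavier_def card_order_on_def)
  ultimately have "{t \<in> S. (t, s) \<in> level_order} \<subset> heavier s"
    by blast
  then show ?thesis
    using True by (metis (no_types, lifting) card_of_Well_order card_of_ordLeq card_inj_on_le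
        linorder_not_less not_ordLeq_iff_ordLess psubset_card_mono finite_subset psubset_imp_subset)
next
  case False
  \<comment> \<open>\<open>L\<close> collects the strictly earlier levels. If it is nonempty, a
    lightest member \<open>t\<close> bounds \<open>|L|\<close> by \<open>|heavier t|\<close>, which
    is below \<open>|heavier s|\<close> because \<open>t\<close> is in \<open>L\<close>.\<close>
  define L where "L = {t \<in> S. |heavier t| <o |heavier s|}"
  have "|L| <o |heavier s|"
  proof (cases "L = {}")
    case True
    have "heavier s \<noteq> {}"
      using False by auto
    then show ?thesis
      using True by (metis card_of_empty2 card_of_empty ordLeq_iff_ordLess_or_ordIso ordIso_symmetric)
  next
    case False
    then obtain t where "t \<in> L" "L \<subseteq> heavier t"
      using subset_heavier[of L] by (auto simp: L_def)
    then show ?thesis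
      using card_of_mono1 ordLeq_ordLess_trans by (fastforce simp: L_def)
  qed
  moreover define r where "r = |level s|"
  \<comment> \<open>A lightest member of the level shows that the whole level has at most \<nu>(s)
    elements; strictness comes from \<open>underS r s\<close> being a proper initial segment of a
    cardinal order.\<close>
  have "|underS r s| <o |heavier s|"
  proof -
    have sl: "s \<in> level s"
      using s card_of_refl by (auto simp: level_def)
    then obtain t where t: "t \<in> level s" "level s \<subseteq> heavier t"
      using subset_heavier[of "level s"] by (auto simp: level_def)
    then have "|level s| \<le>o |heavier s|"
      using card_of_mono1 ordLeq_ordIso_trans by (fastforce simp: level_def)
    then show ?thesis
      using card_of_underS[OF card_of_Card_order, of s "level s"] sl
      by (simp add: r_def Field_card_of ordLess_ordLeq_trans)
  qed
  \<comment> \<open>Two sets smaller than an infinite set have a union that is still smaller, which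
    is where this case needs \<nu>(s) infinite.\<close>
  ultimately have "|L \<union> underS r s| <o |heavier s|"
    using False by (intro card_of_Un_ordLess_infinite)
  moreover have "{t \<in> S. (t, s) \<in> level_order} \<subseteq> L \<union> underS r s"
    by (auto simp: L_def r_def level_order_def underS_def)
  ultimately show ?thesis
    using card_of_mono1 ordLeq_ordLess_trans by blast
qed

text \<open>Greedy choice along \<open>level_order\<close>: by \<open>more\<close> there are at
  least \<open>|heavier s|\<close> admissible values for \<open>s\<close>, and strictly fewer
  predecessors.\<close>

lemma injective_domination:
  assumes Card_order_weight': "\<And>d. Card_order (v d)"
    and more: "\<And>s. s \<in> S \<Longrightarrow> |{t \<in> S. w s \<le>o w t}| \<le>o |{d \<in> T. w s \<le>o v d}|"
  obtains f where "inj_on f S" "f ` S \<subseteq> T" "\<And>s. s \<in> S \<Longrightarrow> w s \<le>o v (f s)"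
proof -
  have "|{t \<in> S. (t, s) \<in> level_order}| <o |{d \<in> T. w s \<le>o v d}|" if "s \<in> S" for s
    using level_order_predecessors[OF that] more[OF that]
    by (auto simp: heavier_def intro: ordLess_ordLeq_trans)
  then obtain f where "inj_on f S" "\<And>s. s \<in> S \<Longrightarrow> f s \<in> {d \<in> T. w s \<le>o v d}"
    using injective_selector[OF wf_level_order level_order_total, of S "\<lambda>s. {d \<in> T. w s \<le>o v d}"]
    by blast
  then show thesis
    using that by blast
qed

end

section \<open>Gluing along the levels of a weight\<close>

text \<open>Elements of different weight have disjoint sets of admissible values, so injections
  chosen on each weight level unite to one injection. The last conclusion records surjectivity onto
  the levels whose counts agree; it is what yields isomorphisms.\<close>

lemma glue_levels:
  fixes w :: "'a \<Rightarrow> 'c rel" and v :: "'b \<Rightarrow> 'd rel"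
  assumes more: "\<And>s. s \<in> S \<Longrightarrow> |{t \<in> S. w t =o w s}| \<le>o |{d \<in> T. v d =o w s}|"
    and Card_order_weight: "\<And>s. Card_order (w s)"
  obtains f where "inj_on f S" "f ` S \<subseteq> T" "\<And>s. s \<in> S \<Longrightarrow> v (f s) =o w s"
    "\<And>s d. s \<in> S \<Longrightarrow> d \<in> T \<Longrightarrow> v d =o w s \<Longrightarrow>
      |{t \<in> S. w t =o w s}| =o |{d \<in> T. v d =o w s}| \<Longrightarrow> d \<in> f ` S"
proof -
  define K where "K = (\<lambda>s. {t \<in> S. w t =o w s})"
  \<comment> \<open>\<open>N\<close> and \<open>g\<close> take the set \<open>K s\<close> as
    argument instead of the representative \<open>s\<close>, so all elements of one level share a
    single injection.\<close>
  define N where "N = (\<lambda>K. {d \<in> T. \<exists>t\<in>K. v d =o w t})"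
  \<comment> \<open>The implication forces the chosen injection to be onto whenever the two levels
    have the same size.\<close>
  define P where "P = (\<lambda>K g. inj_on g K \<and> g ` K \<subseteq> N K \<and> ( |K| =o |N K| \<longrightarrow> g ` K = N K))"
  define g where "g = (\<lambda>K. SOME g. P K g)"
  define f where "f = (\<lambda>s. g (K s) s)"
  have self: "s \<in> K s" if "s \<in> S" for s
    using that Card_order_weight by (simp add: K_def card_order_on_def ordIso_reflexive)
  have K_cong: "K t = K s" if "t \<in> K s" for s t
    using that unfolding K_def by (auto intro: ordIso_transitive ordIso_symmetric)
  have N: "N (K s) = {d \<in> T. v d =o w s}" if "s \<in> S" for s
    using self[OF that] unfolding N_def K_def by (auto intro: ordIso_transitive)
  have P: "P (K s) (g (K s))" if "s \<in> S" for s
  proof -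
    have "|K s| \<le>o |N (K s)|"
      using more[OF that] by (simp add: N[OF that]) (simp add: K_def)
    then have "\<exists>h. P (K s) h"
      unfolding P_def bij_betw_def
      by (metis bij_betw_def card_of_ordIso card_of_ordLeq order_refl)
    then show ?thesis
      unfolding g_def by (rule someI_ex)
  qed
  have f_eq: "f t = g (K s) t" if "t \<in> K s" for s t
    using K_cong[OF that] by (simp add: f_def)
  have range: "f s \<in> T \<and> v (f s) =o w s" if "s \<in> S" for s
    using P[OF that] self[OF that] N[OF that] by (auto simp: P_def f_def)
  have "inj_on f S"
  proof (rule inj_onI)
    fix s t assume *: "s \<in> S" "t \<in> S" "f s = f t"
    \<comment> \<open>The weight of the common value determines the weight of its argument, so
      \<open>s\<close> and \<open>t\<close> lie in one level, where the injection separates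
      them.\<close>
    then have "t \<in> K s"
      using range[of s] range[of t] by (auto simp: K_def intro: ordIso_transitive ordIso_symmetric)
    then show "s = t"
      using * P[OF *(1)] self[OF *(1)] f_eq[of t s] f_eq[of s s] by (auto simp: P_def inj_on_def)
  qed
  moreover have "d \<in> f ` S" if "s \<in> S" "d \<in> T" "v d =o w s"
    "|{t \<in> S. w t =o w s}| =o |{d \<in> T. v d =o w s}|" for s d
  proof -
    have "g (K s) ` K s = N (K s)"
      using P[OF that(1)] that(4) N[OF that(1)] by (simp add: P_def) (simp add: K_def)
    then have "d \<in> g (K s) ` K s"
      using that N[OF that(1)] by simp
    also have "\<dots> = f ` K s"
      using f_eq by simp
    finally show ?thesis
      by (auto simp: K_def)
  qed
  ultimately show thesis
    using that range by blast
qed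

section \<open>Homomorphisms and maps between classes\<close>

lemma induced_map_in_quotient:
  assumes "equiv X E" "equiv Y F" "homomorphism X E Y F \<phi>" "C \<in> X // E"
  shows "induced_map F \<phi> C \<in> Y // F"
  using assms(4)
proof (rule quotientE)
  fix x assume "x \<in> X" "C = E `` {x}"
  then show ?thesis
    using induced_map_class[OF assms(1-3)] assms(3)
    by (auto simp: homomorphism_def intro: quotientI)
qed

lemma image_subset_induced_map:
  assumes "equiv X E" "equiv Y F" "homomorphism X E Y F \<phi>" "C \<in> X // E"
  shows "\<phi> ` C \<subseteq> induced_map F \<phi> C"
proof -
  have "C \<subseteq> X"
    using Union_quotient[OF assms(1)] assms(4) by blast
  then have "\<phi> ` C \<subseteq> Y"
    using assms(3) by (auto simp: homomorphism_def)
  then show ?thesis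
    using equiv_class_self[OF assms(2)] by (auto simp: induced_map_def)
qed

lemma card_of_class_le_induced_map:
  assumes "equiv X E" "equiv Y F" "homomorphism X E Y F \<phi>" "inj_on \<phi> X" "C \<in> X // E"
  shows "|C| \<le>o |induced_map F \<phi> C|"
proof -
  have "inj_on \<phi> C"
    using assms(1,4,5) by (metis Union_quotient Union_upper inj_on_subset)
  then show ?thesis
    using image_subset_induced_map[OF assms(1-3,5)] by (metis card_of_ordLeqI image_subset_iff)
qed

text \<open>By invariance every point of the target class has a preimage. The class of that preimage
  has the same image under the induced map as \<open>C\<close>, hence equals \<open>C\<close> by
  injectivity.\<close>

lemma induced_map_eq_image:
  assumes E: "equiv X E" and F: "equiv Y F" and hom: "homomorphism X E Y F \<phi>"
    and inj: "inj_on (induced_map F \<phi>) (X // E)" and inv: "invariant F (\<phi> ` X)"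
    and C: "C \<in> X // E"
  shows "induced_map F \<phi> C = \<phi> ` C"
proof
  show "induced_map F \<phi> C \<subseteq> \<phi> ` C"
  proof
    fix y assume y: "y \<in> induced_map F \<phi> C"
    obtain x where x: "x \<in> X" "C = E `` {x}"
      using C by (rule quotientE)
    then have "(\<phi> x, y) \<in> F"
      using y induced_map_class[OF E F hom] by simp
    moreover from this obtain x' where x': "x' \<in> X" "y = \<phi> x'"
      using inv x(1) unfolding invariant_def by blast
    ultimately have "induced_map F \<phi> (E `` {x'}) = induced_map F \<phi> C"
      using x induced_map_class[OF E F hom] equiv_class_eq[OF F] by simp
    then have "E `` {x'} = C"
      using inj C x'(1) by (auto intro: quotientI dest: inj_onD)
    then show "y \<in> \<phi> ` C"
      using x' equiv_class_self[OF E] by blast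
  qed
qed (rule image_subset_induced_map[OF E F hom C])

lemma card_of_induced_map_le:
  assumes "equiv X E" "equiv Y F" "homomorphism X E Y F \<phi>"
    "inj_on (induced_map F \<phi>) (X // E)" "invariant F (\<phi> ` X)" "C \<in> X // E"
  shows "|induced_map F \<phi> C| \<le>o |C|"
  using induced_map_eq_image[OF assms] by (simp add: card_of_image)

section \<open>Homomorphisms glued from maps between classes\<close>

lemma glue_classes:
  assumes E: "equiv X E" and F: "equiv Y F" and f: "f ` (X // E) \<subseteq> Y // F"
    and h: "\<And>C. C \<in> X // E \<Longrightarrow> h C ` C \<subseteq> f C"
  obtains \<phi> where "homomorphism X E Y F \<phi>" "\<And>C. C \<in> X // E \<Longrightarrow> induced_map F \<phi> C = f C"
    "\<And>C x. C \<in> X // E \<Longrightarrow> x \<in> C \<Longrightarrow> \<phi> x = h C x"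
proof
  \<comment> \<open>The classes partition \<open>X\<close>, so each point can use the map attached
    to its own class.\<close>
  define \<phi> where "\<phi> x = h (E `` {x}) x" for x
  show glue: "\<phi> x = h C x" if "C \<in> X // E" "x \<in> C" for C x
    using that quotient_eq_iff[OF E that(1)] by (metis E Image_singleton_iff \<phi>_def equiv_class_eq quotientE)
  have in_f: "\<phi> x \<in> f C" if "C \<in> X // E" "x \<in> C" for C x
    using that h glue by auto
  show hom: "homomorphism X E Y F \<phi>"
    unfolding homomorphism_def
  proof (intro conjI ballI impI subsetI)
    fix y assume "y \<in> \<phi> ` X"
    then obtain x where "x \<in> X" "y = \<phi> x"
      by blast
    then have "y \<in> f (E `` {x})" "f (E `` {x}) \<in> Y // F"
      using f in_f[of "E `` {x}" x] equiv_class_self[OF E] by (auto intro: quotientI)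
    then show "y \<in> Y"
      using F by (metis UnionI Union_quotient)
  next
    fix x x' assume "x \<in> X" "x' \<in> X" "(x, x') \<in> E"
    then have "\<phi> x \<in> f (E `` {x})" "\<phi> x' \<in> f (E `` {x})" "f (E `` {x}) \<in> Y // F"
      using f in_f[of "E `` {x}"] equiv_class_self[OF E] by (auto intro: quotientI)
    then show "(\<phi> x, \<phi> x') \<in> F"
      by (meson F quotient_eqI quotient_eq_iff)
  qed
  show "induced_map F \<phi> C = f C" if C: "C \<in> X // E" for C
  proof -
    obtain x where x: "x \<in> C"
      using C E in_quotient_imp_non_empty by blast
    \<comment> \<open>Two classes of \<open>F\<close> sharing the point \<open>\<phi> x\<close>
      coincide.\<close>
    then have "\<phi> x \<in> induced_map F \<phi> C \<inter> f C"
      using image_subset_induced_map[OF E F hom C] in_f[OF C x] by blast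
    then show ?thesis
      using quotient_disj[OF F induced_map_in_quotient[OF E F hom C], of "f C"] f C by blast
  qed
qed

text \<open>Points of one class are separated by the injection on that class, points of different
  classes by the disjointness of the distinct target classes. Choosing bijections where sizes agree
  makes the image of such a class a full class of \<open>F\<close>.\<close>

lemma glue_classes_injective:
  assumes E: "equiv X E" and F: "equiv Y F"
    and f: "f ` (X // E) \<subseteq> Y // F" and inj: "inj_on f (X // E)"
    and le: "\<And>C. C \<in> X // E \<Longrightarrow> |C| \<le>o |f C|"
  obtains \<phi> where "homomorphism X E Y F \<phi>" "\<And>C. C \<in> X // E \<Longrightarrow> induced_map F \<phi> C = f C"
    "inj_on \<phi> X" "\<And>C. C \<in> X // E \<Longrightarrow> |C| =o |f C| \<Longrightarrow> \<phi> ` C = f C"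
proof -
  have "\<exists>h. inj_on h C \<and> h ` C \<subseteq> f C \<and> ( |C| =o |f C| \<longrightarrow> h ` C = f C)" if "C \<in> X // E" for C
    using le[OF that] by (metis bij_betw_def card_of_ordIso card_of_ordLeq order_refl)
  then obtain h where h: "\<And>C. C \<in> X // E \<Longrightarrow>
      inj_on (h C) C \<and> h C ` C \<subseteq> f C \<and> ( |C| =o |f C| \<longrightarrow> h C ` C = f C)"
    by metis
  then have into: "\<And>C. C \<in> X // E \<Longrightarrow> h C ` C \<subseteq> f C"
    by blast
  obtain \<phi> where \<phi>: "homomorphism X E Y F \<phi>"
      "\<And>C. C \<in> X // E \<Longrightarrow> induced_map F \<phi> C = f C"
      "\<And>C x. C \<in> X // E \<Longrightarrow> x \<in> C \<Longrightarrow> \<phi> x = h C x"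
    by (rule glue_classes[OF E F f into]) (auto intro: that)
  have "inj_on \<phi> X"
  proof (rule inj_onI)
    fix x x' assume *: "x \<in> X" "x' \<in> X" "\<phi> x = \<phi> x'"
    let ?C = "E `` {x}" and ?C' = "E `` {x'}"
    have C: "?C \<in> X // E" "?C' \<in> X // E" "x \<in> ?C" "x' \<in> ?C'"
      using * equiv_class_self[OF E] by (auto intro: quotientI)
    then have "\<phi> x \<in> f ?C" "\<phi> x' \<in> f ?C'" "f ?C \<in> Y // F" "f ?C' \<in> Y // F"
      using h \<phi>(3) f by auto
    then have "f ?C = f ?C'"
      using * quotient_disj[OF F, of "f ?C" "f ?C'"] by auto
    then have "?C = ?C'"
      using inj C by (auto dest: inj_onD)
    then show "x = x'"
      using * C \<phi>(3) h by (metis inj_onD)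
  qed
  moreover have "\<phi> ` C = f C" if "C \<in> X // E" "|C| =o |f C|" for C
    using h[OF that(1)] that \<phi>(3) by (metis image_cong)
  ultimately show thesis
    by (intro that[OF \<phi>(1,2)])
qed

lemma invariant_Union_quotient:
  assumes "equiv Y F" "B \<subseteq> Y // F"
  shows "invariant F (\<Union>B)"
  unfolding invariant_def using assms in_quotient_imp_closed[OF assms(1)] by blast

lemma image_eq_Union_classes:
  assumes "equiv X E" "\<And>C. C \<in> X // E \<Longrightarrow> \<phi> ` C = f C"
  shows "\<phi> ` X = \<Union>(f ` (X // E))"
proof -
  have "\<phi> ` X = \<phi> ` \<Union>(X // E)"
    using Union_quotient[OF assms(1)] by simp
  also have "\<dots> = \<Union>(f ` (X // E))"
    using assms(2) by (auto simp: image_Union)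
  finally show ?thesis .
qed

lemma glue_classes_surjective:
  assumes E: "equiv X E" and F: "equiv Y F" and f: "f ` (X // E) \<subseteq> Y // F"
    and le: "\<And>C. C \<in> X // E \<Longrightarrow> |f C| \<le>o |C|"
  obtains \<phi> where "homomorphism X E Y F \<phi>" "\<And>C. C \<in> X // E \<Longrightarrow> induced_map F \<phi> C = f C"
    "\<And>C. C \<in> X // E \<Longrightarrow> \<phi> ` C = f C"
proof -
  \<comment> \<open>A cardinal inequality yields a surjection only onto a nonempty set; classes are
    nonempty.\<close>
  have "\<exists>h. h ` C = f C" if "C \<in> X // E" for C
    using le[OF that] f that in_quotient_imp_non_empty[OF F, of "f C"]
    by (metis card_of_ordLeq2 image_subset_iff)
  then obtain h where h: "\<And>C. C \<in> X // E \<Longrightarrow> h C ` C = f C"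
    by metis
  obtain \<phi> where \<phi>: "homomorphism X E Y F \<phi>"
      "\<And>C. C \<in> X // E \<Longrightarrow> induced_map F \<phi> C = f C"
      "\<And>C x. C \<in> X // E \<Longrightarrow> x \<in> C \<Longrightarrow> \<phi> x = h C x"
    by (rule glue_classes[OF E F f equalityD1[OF h]]) (auto intro: that)
  moreover have "\<phi> ` C = f C" if "C \<in> X // E" for C
    using h[OF that] \<phi>(3)[OF that] by (metis image_cong)
  ultimately show thesis
    by (intro that)
qed

section \<open>Reducibility in terms of class sizes\<close>

context
  fixes X :: "'a set" and E :: "'a rel" and Y :: "'b set" and F :: "'b rel"
  assumes E: "equiv X E" and F: "equiv Y F"
begin

lemma induced_map_image: "homomorphism X E Y F \<phi> \<Longrightarrow> induced_map F \<phi> ` (X // E) \<subseteq> Y // F"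
  using induced_map_in_quotient[OF E F] by blast

text \<open>No size comparison is available here, so each class is collapsed to a single point of
  its target class.\<close>

lemma glue_constant:
  assumes "f ` (X // E) \<subseteq> Y // F"
  obtains \<phi> where "homomorphism X E Y F \<phi>" "\<And>C. C \<in> X // E \<Longrightarrow> induced_map F \<phi> C = f C"
proof -
  have "(\<lambda>_. SOME y. y \<in> f C) ` C \<subseteq> f C" if "C \<in> X // E" for C
    using that assms in_quotient_imp_non_empty[OF F, of "f C"] by (auto simp: some_in_eq)
  then show thesis
    by (rule glue_classes[OF E F assms]) (auto intro: that)
qed

text \<open>In this and the following characterizations, the map between classes obtained from a
  homomorphism is its induced map, and conversely the homomorphism is glued so as to induce the
  given map.\<close>

lemma reducible_iff_map:
  "reducible X E Y F \<longleftrightarrow> (\<exists>f. inj_on f (X // E) \<and> f ` (X // E) \<subseteq> Y // F)"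
proof
  assume "\<exists>f. inj_on f (X // E) \<and> f ` (X // E) \<subseteq> Y // F"
  then obtain f where f: "inj_on f (X // E)" "f ` (X // E) \<subseteq> Y // F"
    by blast
  obtain \<phi> where \<phi>: "homomorphism X E Y F \<phi>" "\<And>C. C \<in> X // E \<Longrightarrow> induced_map F \<phi> C = f C"
    by (rule glue_constant[OF f(2)]) (auto intro: that)
  then have "inj_on (induced_map F \<phi>) (X // E)"
    using f(1) inj_on_cong by blast
  then show "reducible X E Y F"
    using \<phi>(1) unfolding reducible_def is_reduction_def by blast
qed (use induced_map_image in \<open>auto simp: reducible_def is_reduction_def\<close>)

lemma fully_reducible_iff_map:
  "fully_reducible X E Y F \<longleftrightarrow> (\<exists>f. bij_betw f (X // E) (Y // F))"
proof
  assume "\<exists>f. bij_betw f (X // E) (Y // F)"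
  then obtain f where f: "bij_betw f (X // E) (Y // F)"
    by blast
  then have into: "f ` (X // E) \<subseteq> Y // F"
    by (simp add: bij_betw_def)
  obtain \<phi> where \<phi>: "homomorphism X E Y F \<phi>" "\<And>C. C \<in> X // E \<Longrightarrow> induced_map F \<phi> C = f C"
    by (rule glue_constant[OF into]) (auto intro: that)
  then have "bij_betw (induced_map F \<phi>) (X // E) (Y // F)"
    using f bij_betw_cong by blast
  then show "fully_reducible X E Y F"
    using \<phi>(1) unfolding fully_reducible_def is_full_reduction_def bij_betw_def by blast
qed (auto simp: fully_reducible_def is_full_reduction_def bij_betw_def)

lemma embeddable_iff_map:
  "embeddable X E Y F \<longleftrightarrow>
     (\<exists>f. inj_on f (X // E) \<and> f ` (X // E) \<subseteq> Y // F \<and> (\<forall>C\<in>X // E. |C| \<le>o |f C| ))"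
proof
  assume "embeddable X E Y F"
  then obtain \<phi> where "is_embedding X E Y F \<phi>"
    unfolding embeddable_def by blast
  then show "\<exists>f. inj_on f (X // E) \<and> f ` (X // E) \<subseteq> Y // F \<and> (\<forall>C\<in>X // E. |C| \<le>o |f C| )"
    using induced_map_image card_of_class_le_induced_map[OF E F]
    unfolding is_embedding_def by (intro exI[of _ "induced_map F \<phi>"]) blast
next
  assume "\<exists>f. inj_on f (X // E) \<and> f ` (X // E) \<subseteq> Y // F \<and> (\<forall>C\<in>X // E. |C| \<le>o |f C| )"
  then obtain f where f: "f ` (X // E) \<subseteq> Y // F" "inj_on f (X // E)"
      "\<And>C. C \<in> X // E \<Longrightarrow> |C| \<le>o |f C|"
    by blast
  obtain \<phi> where \<phi>: "homomorphism X E Y F \<phi>"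
      "\<And>C. C \<in> X // E \<Longrightarrow> induced_map F \<phi> C = f C" "inj_on \<phi> X"
    by (rule glue_classes_injective[OF E F f]) (auto intro: that)
  then have "inj_on (induced_map F \<phi>) (X // E)"
    using f(2) inj_on_cong by blast
  then show "embeddable X E Y F"
    using \<phi>(1,3) unfolding embeddable_def is_embedding_def by blast
qed

lemma fully_embeddable_iff_map:
  "fully_embeddable X E Y F \<longleftrightarrow>
     (\<exists>f. bij_betw f (X // E) (Y // F) \<and> (\<forall>C\<in>X // E. |C| \<le>o |f C| ))"
proof
  assume "fully_embeddable X E Y F"
  then obtain \<phi> where "is_full_embedding X E Y F \<phi>"
    unfolding fully_embeddable_def by blast
  then show "\<exists>f. bij_betw f (X // E) (Y // F) \<and> (\<forall>C\<in>X // E. |C| \<le>o |f C| )"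
    using card_of_class_le_induced_map[OF E F]
    unfolding is_full_embedding_def bij_betw_def by (intro exI[of _ "induced_map F \<phi>"]) blast
next
  assume "\<exists>f. bij_betw f (X // E) (Y // F) \<and> (\<forall>C\<in>X // E. |C| \<le>o |f C| )"
  then obtain f where f: "bij_betw f (X // E) (Y // F)" "\<And>C. C\<in>X // E \<Longrightarrow> |C| \<le>o |f C|"
    by blast
  have into: "f ` (X // E) \<subseteq> Y // F" and inj: "inj_on f (X // E)"
    using f(1) by (simp_all add: bij_betw_def)
  obtain \<phi> where \<phi>: "homomorphism X E Y F \<phi>"
      "\<And>C. C \<in> X // E \<Longrightarrow> induced_map F \<phi> C = f C" "inj_on \<phi> X"
    by (rule glue_classes_injective[OF E F into inj f(2)]) (auto intro: that)
  then have "bij_betw (induced_map F \<phi>) (X // E) (Y // F)"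
    using f(1) bij_betw_cong by blast
  then show "fully_embeddable X E Y F"
    using \<phi>(1,3) unfolding fully_embeddable_def is_full_embedding_def bij_betw_def by blast
qed

text \<open>Injectivity of the induced map and invariance make each class surject onto its target
  class, so sizes cannot increase.\<close>

lemma invariantly_reducible_imp_map:
  assumes "invariantly_reducible X E Y F"
  shows "\<exists>f. inj_on f (X // E) \<and> f ` (X // E) \<subseteq> Y // F \<and> (\<forall>C\<in>X // E. |f C| \<le>o |C| )"
proof -
  obtain \<phi> where "is_invariant_reduction X E Y F \<phi>"
    using assms unfolding invariantly_reducible_def by blast
  then show ?thesis
    using induced_map_image card_of_induced_map_le[OF E F]
    unfolding is_invariant_reduction_def by (intro exI[of _ "induced_map F \<phi>"]) blast
qed

lemma surjectively_reducible_iff_map: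
  "surjectively_reducible X E Y F \<longleftrightarrow>
     (\<exists>f. bij_betw f (X // E) (Y // F) \<and> (\<forall>C\<in>X // E. |f C| \<le>o |C| ))"
proof
  assume "surjectively_reducible X E Y F"
  then obtain \<phi> where "is_surjective_reduction X E Y F \<phi>"
    unfolding surjectively_reducible_def by blast
  then show "\<exists>f. bij_betw f (X // E) (Y // F) \<and> (\<forall>C\<in>X // E. |f C| \<le>o |C| )"
    using card_of_induced_map_le[OF E F]
    unfolding is_surjective_reduction_def bij_betw_def
    by (intro exI[of _ "induced_map F \<phi>"]) blast
next
  assume "\<exists>f. bij_betw f (X // E) (Y // F) \<and> (\<forall>C\<in>X // E. |f C| \<le>o |C| )"
  then obtain f where f: "bij_betw f (X // E) (Y // F)" "\<And>C. C\<in>X // E \<Longrightarrow> |f C| \<le>o |C|"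
    by blast
  have into: "f ` (X // E) \<subseteq> Y // F"
    using f(1) by (simp add: bij_betw_def)
  obtain \<phi> where \<phi>: "homomorphism X E Y F \<phi>"
      "\<And>C. C \<in> X // E \<Longrightarrow> induced_map F \<phi> C = f C" "\<And>C. C \<in> X // E \<Longrightarrow> \<phi> ` C = f C"
    by (rule glue_classes_surjective[OF E F into f(2)]) (auto intro: that)
  have bij: "bij_betw (induced_map F \<phi>) (X // E) (Y // F)"
    using f(1) \<phi>(2) bij_betw_cong by blast
  \<comment> \<open>Each class covers its target class and \<open>f\<close> reaches all of
    \<open>Y // F\<close>; this union is \<open>Y\<close>, giving surjectivity and invariance
    together.\<close>
  have "\<phi> ` X = \<Union>(Y // F)"
    using image_eq_Union_classes[OF E, of \<phi> f] \<phi>(3) f(1) by (simp add: bij_betw_def)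
  then show "surjectively_reducible X E Y F"
    using \<phi>(1) bij invariant_Union_quotient[OF F order_refl]
    unfolding surjectively_reducible_def is_surjective_reduction_def bij_betw_def
    by (auto simp: Union_quotient[OF F])
qed

text \<open>Equality of sizes splits into two bounds: injectivity of \<open>\<phi>\<close> gives
  \<open>|C| \<le>o |f C|\<close>, and invariance gives the reverse.\<close>

lemma isomorphic_iff_map:
  "isomorphic X E Y F \<longleftrightarrow>
     (\<exists>f. bij_betw f (X // E) (Y // F) \<and> (\<forall>C\<in>X // E. |f C| =o |C| ))"
proof
  assume "isomorphic X E Y F"
  then obtain \<phi> where "is_isomorphism X E Y F \<phi>"
    unfolding isomorphic_def by blast
  then show "\<exists>f. bij_betw f (X // E) (Y // F) \<and> (\<forall>C\<in>X // E. |f C| =o |C| )"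
    using card_of_induced_map_le[OF E F] card_of_class_le_induced_map[OF E F]
    unfolding is_isomorphism_def bij_betw_def ordIso_iff_ordLeq
    by (intro exI[of _ "induced_map F \<phi>"]) blast
next
  assume "\<exists>f. bij_betw f (X // E) (Y // F) \<and> (\<forall>C\<in>X // E. |f C| =o |C| )"
  then obtain f where f: "bij_betw f (X // E) (Y // F)" "\<And>C. C\<in>X // E \<Longrightarrow> |C| =o |f C|"
    using ordIso_symmetric by blast
  have into: "f ` (X // E) \<subseteq> Y // F" and inj: "inj_on f (X // E)"
    using f(1) by (simp_all add: bij_betw_def)
  obtain \<phi> where \<phi>: "homomorphism X E Y F \<phi>" "inj_on \<phi> X"
      "\<And>C. C \<in> X // E \<Longrightarrow> induced_map F \<phi> C = f C" "\<And>C. C \<in> X // E \<Longrightarrow> \<phi> ` C = f C"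
    by (rule glue_classes_injective[OF E F into inj ordIso_imp_ordLeq[OF f(2)]]) (auto intro: that simp: f(2))
  have bij: "bij_betw (induced_map F \<phi>) (X // E) (Y // F)"
    using f(1) \<phi>(3) bij_betw_cong by blast
  have "\<phi> ` X = \<Union>(Y // F)"
    using image_eq_Union_classes[OF E, of \<phi> f] \<phi>(4) f(1) by (simp add: bij_betw_def)
  then show "isomorphic X E Y F"
    using \<phi>(1,2) bij invariant_Union_quotient[OF F order_refl]
    unfolding isomorphic_def is_isomorphism_def bij_betw_def
    by (auto simp: Union_quotient[OF F])
qed

lemma invariantly_embeddable_iff_map:
  "invariantly_embeddable X E Y F \<longleftrightarrow>
     (\<exists>f. inj_on f (X // E) \<and> f ` (X // E) \<subseteq> Y // F \<and> (\<forall>C\<in>X // E. |f C| =o |C| ))"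
proof
  assume "invariantly_embeddable X E Y F"
  then obtain \<phi> where "is_invariant_embedding X E Y F \<phi>"
    unfolding invariantly_embeddable_def by blast
  then show "\<exists>f. inj_on f (X // E) \<and> f ` (X // E) \<subseteq> Y // F \<and> (\<forall>C\<in>X // E. |f C| =o |C| )"
    using card_of_induced_map_le[OF E F] card_of_class_le_induced_map[OF E F] induced_map_image
    unfolding is_invariant_embedding_def ordIso_iff_ordLeq
    by (intro exI[of _ "induced_map F \<phi>"]) blast
next
  assume "\<exists>f. inj_on f (X // E) \<and> f ` (X // E) \<subseteq> Y // F \<and> (\<forall>C\<in>X // E. |f C| =o |C| )"
  then obtain f where f: "inj_on f (X // E)" "f ` (X // E) \<subseteq> Y // F"
      "\<And>C. C\<in>X // E \<Longrightarrow> |f C| =o |C|"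
    by blast
  have eq: "\<And>C. C\<in>X // E \<Longrightarrow> |C| =o |f C|"
    using f(3) by (rule ordIso_symmetric)
  obtain \<phi> where \<phi>: "homomorphism X E Y F \<phi>" "inj_on \<phi> X"
      "\<And>C. C \<in> X // E \<Longrightarrow> induced_map F \<phi> C = f C" "\<And>C. C \<in> X // E \<Longrightarrow> \<phi> ` C = f C"
    by (rule glue_classes_injective[OF E F f(2,1) ordIso_imp_ordLeq[OF eq]]) (auto intro: that simp: eq)
  have "inj_on (induced_map F \<phi>) (X // E)"
    using f(1) \<phi>(3) inj_on_cong by blast
  \<comment> \<open>The range is a union of classes of \<open>F\<close>, possibly not all of them;
    that is enough for invariance.\<close>
  moreover have "\<phi> ` X = \<Union>(f ` (X // E))"
    using image_eq_Union_classes[OF E, of \<phi> f] \<phi>(4) by simp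
  then have "invariant F (\<phi> ` X)"
    using invariant_Union_quotient[OF F f(2)] by simp
  ultimately show "invariantly_embeddable X E Y F"
    using \<phi>(1,2) unfolding invariantly_embeddable_def is_invariant_embedding_def by blast
qed

end

section \<open>Counting classes\<close>

lemma card_of_filter_le:
  assumes "inj_on f A" "f ` A \<subseteq> B" "\<And>a. a \<in> A \<Longrightarrow> P a \<Longrightarrow> Q (f a)"
  shows "|{a \<in> A. P a}| \<le>o |{b \<in> B. Q b}|"
proof (rule card_of_ordLeqI)
  show "inj_on f {a \<in> A. P a}"
    using assms(1) by (rule inj_on_subset) blast
qed (use assms(2,3) in blast)

lemma card_of_filter_ge:
  assumes "bij_betw f A B" "\<And>a. a \<in> A \<Longrightarrow> Q (f a) \<Longrightarrow> P a"
  shows "|{b \<in> B. Q b}| \<le>o |{a \<in> A. P a}|"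
proof -
  have "{b \<in> B. Q b} \<subseteq> f ` {a \<in> A. P a}"
    using assms by (auto simp: bij_betw_def)
  then show ?thesis
    using card_of_image card_of_mono1 ordLeq_transitive by blast
qed

text \<open>Equipotent cardinals select literally the same classes, so a count may be moved between
  cardinals on different types.\<close>

lemma n_ge_cong:
  fixes \<kappa> :: "'k rel" and \<kappa>' :: "'l rel"
  assumes "\<kappa> =o \<kappa>'"
  shows "n_ge \<kappa> (X :: 'a set) E = n_ge \<kappa>' X E"
proof -
  have "\<kappa> \<le>o |C| \<longleftrightarrow> \<kappa>' \<le>o |C|" for C :: "'a set"
    using ordIso_ordLeq_trans[OF assms, of "|C|"]
      ordIso_ordLeq_trans[OF ordIso_symmetric[OF assms], of "|C|"] by blast
  then show ?thesis
    by (simp add: n_ge_def)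
qed

lemma n_eq_cong:
  fixes \<kappa> :: "'k rel" and \<kappa>' :: "'l rel"
  assumes "\<kappa> =o \<kappa>'"
  shows "n_eq \<kappa> (X :: 'a set) E = n_eq \<kappa>' X E"
proof -
  have "|C| =o \<kappa> \<longleftrightarrow> |C| =o \<kappa>'" for C :: "'a set"
    using ordIso_transitive[of "|C|", OF _ assms]
      ordIso_transitive[of "|C|", OF _ ordIso_symmetric[OF assms]] by blast
  then show ?thesis
    by (simp add: n_eq_def)
qed

lemma card_order_in_larger_type:
  fixes A :: "'a set"
  assumes "inj (i :: 'a \<Rightarrow> 'c)"
  shows "\<exists>\<kappa> :: 'c rel. Card_order \<kappa> \<and> \<kappa> =o |A|"
proof -
  have "bij_betw i A (i ` A)"
    using assms by (meson inj_on_imp_bij_betw inj_on_subset subset_UNIV)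
  then have "|i ` A| =o |A|"
    using card_of_ordIsoI ordIso_symmetric by blast
  then show ?thesis
    using card_of_Card_order by blast
qed

section \<open>Class counts and maps between classes compared\<close>

theorem theorem5:
  fixes X :: "'a set" and E :: "'a rel" and Y :: "'b set" and F :: "'b rel"
  assumes "equiv X E" and "equiv Y F"
  shows
    "(reducible X E Y F \<longleftrightarrow> |X // E| \<le>o |Y // F| ) \<and>
     (embeddable X E Y F \<longleftrightarrow>
        (\<forall>\<kappa> :: ('k + 'a + 'b) rel. Card_order \<kappa> \<longrightarrow> n_ge \<kappa> X E \<le>o n_ge \<kappa> Y F)) \<and>
     (surjectively_reducible X E Y F \<longrightarrow>
        (\<forall>\<kappa> :: ('k + 'a + 'b) rel. Card_order \<kappa> \<longrightarrow>
           n_le \<kappa> X E \<le>o n_le \<kappa> Y F \<and> n_ge \<kappa> Y F \<le>o n_ge \<kappa> X E)) \<and>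
     (isomorphic X E Y F \<longleftrightarrow>
        (\<forall>\<kappa> :: ('k + 'a + 'b) rel. Card_order \<kappa> \<longrightarrow> n_eq \<kappa> X E =o n_eq \<kappa> Y F)) \<and>
     (invariantly_reducible X E Y F \<longrightarrow>
        (\<forall>\<kappa> :: ('k + 'a + 'b) rel. Card_order \<kappa> \<longrightarrow> n_le \<kappa> X E \<le>o n_le \<kappa> Y F)) \<and>
     (fully_reducible X E Y F \<longleftrightarrow> |X // E| =o |Y // F| ) \<and>
     (invariantly_embeddable X E Y F \<longleftrightarrow>
        (\<forall>\<kappa> :: ('k + 'a + 'b) rel. Card_order \<kappa> \<longrightarrow> n_eq \<kappa> X E \<le>o n_eq \<kappa> Y F)) \<and>
     (fully_embeddable X E Y F \<longleftrightarrow> surjectively_reducible Y F X E)"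
proof (intro conjI)
  note E = assms(1) and F = assms(2)
  \<comment> \<open>Class sizes are cardinals on \<open>'a\<close> or \<open>'b\<close>, while
    \<kappa> lives on the sum type; the inclusions of the summands supply copies.\<close>
  have exX: "\<exists>\<kappa> :: ('k + 'a + 'b) rel. Card_order \<kappa> \<and> \<kappa> =o |C|" for C :: "'a set"
    by (rule card_order_in_larger_type[of "Inr \<circ> Inl"]) (auto intro: injI)
  have exY: "\<exists>\<kappa> :: ('k + 'a + 'b) rel. Card_order \<kappa> \<and> \<kappa> =o |D|" for D :: "'b set"
    by (rule card_order_in_larger_type[of "Inr \<circ> Inr"]) (auto intro: injI)
  show "reducible X E Y F \<longleftrightarrow> |X // E| \<le>o |Y // F|"
    using reducible_iff_map[OF E F] card_of_ordLeq[of "X // E" "Y // F"] by simp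
  show "fully_reducible X E Y F \<longleftrightarrow> |X // E| =o |Y // F|"
    using fully_reducible_iff_map[OF E F] card_of_ordIso[of "X // E" "Y // F"] by simp
  show "embeddable X E Y F \<longleftrightarrow>
      (\<forall>\<kappa> :: ('k + 'a + 'b) rel. Card_order \<kappa> \<longrightarrow> n_ge \<kappa> X E \<le>o n_ge \<kappa> Y F)"
  proof (intro iffI allI impI)
    fix \<kappa> :: "('k + 'a + 'b) rel" assume "embeddable X E Y F"
    then obtain f where f: "inj_on f (X // E)" "f ` (X // E) \<subseteq> Y // F"
        "\<And>C. C \<in> X // E \<Longrightarrow> |C| \<le>o |f C|"
      using embeddable_iff_map[OF E F] by blast
    show "n_ge \<kappa> X E \<le>o n_ge \<kappa> Y F"
      unfolding n_ge_def
      by (rule card_of_filter_le[OF f(1,2)]) (rule ordLeq_transitive[OF _ f(3)])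
  next
    assume *: "\<forall>\<kappa> :: ('k + 'a + 'b) rel. Card_order \<kappa> \<longrightarrow> n_ge \<kappa> X E \<le>o n_ge \<kappa> Y F"
    have le: "n_ge |C| X E \<le>o n_ge |C| Y F" for C :: "'a set"
      using exX[of C] * by (metis n_ge_cong)
    \<comment> \<open>The weight of a class is its cardinality, so \<open>le\<close> says that
      \<open>F\<close> has at least as many classes large enough for \<open>C\<close> as
      \<open>E\<close> has.\<close>
    obtain f where "inj_on f (X // E)" "f ` (X // E) \<subseteq> Y // F"
        "\<And>C. C \<in> X // E \<Longrightarrow> |C| \<le>o |f C|"
      by (rule injective_domination[of card_of card_of "X // E" "Y // F",
            OF card_of_Card_order card_of_Card_order le[unfolded n_ge_def]]) (auto intro: that)
    then show "embeddable X E Y F"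
      using embeddable_iff_map[OF E F] by blast
  qed
  show "surjectively_reducible X E Y F \<longrightarrow> (\<forall>\<kappa> :: ('k + 'a + 'b) rel. Card_order \<kappa> \<longrightarrow>
      n_le \<kappa> X E \<le>o n_le \<kappa> Y F \<and> n_ge \<kappa> Y F \<le>o n_ge \<kappa> X E)"
  proof (intro impI allI)
    fix \<kappa> :: "('k + 'a + 'b) rel" assume "surjectively_reducible X E Y F"
    then obtain f where f: "bij_betw f (X // E) (Y // F)" "\<And>C. C \<in> X // E \<Longrightarrow> |f C| \<le>o |C|"
      using surjectively_reducible_iff_map[OF E F] by blast
    have "n_le \<kappa> X E \<le>o n_le \<kappa> Y F"
      unfolding n_le_def
      by (rule card_of_filter_le[OF bij_betw_imp_inj_on[OF f(1)] bij_betw_imp_surj_on[OF f(1), THEN equalityD1]])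
        (rule ordLeq_transitive[OF f(2)])
    moreover have "n_ge \<kappa> Y F \<le>o n_ge \<kappa> X E"
      unfolding n_ge_def
      by (rule card_of_filter_ge[OF f(1)]) (rule ordLeq_transitive[OF _ f(2)])
    ultimately show "n_le \<kappa> X E \<le>o n_le \<kappa> Y F \<and> n_ge \<kappa> Y F \<le>o n_ge \<kappa> X E"
      by blast
  qed
  show "invariantly_reducible X E Y F \<longrightarrow>
      (\<forall>\<kappa> :: ('k + 'a + 'b) rel. Card_order \<kappa> \<longrightarrow> n_le \<kappa> X E \<le>o n_le \<kappa> Y F)"
  proof (intro impI allI)
    fix \<kappa> :: "('k + 'a + 'b) rel" assume "invariantly_reducible X E Y F"
    from invariantly_reducible_imp_map[OF E F this]
    obtain f where f: "inj_on f (X // E)" "f ` (X // E) \<subseteq> Y // F"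
        "\<And>C. C \<in> X // E \<Longrightarrow> |f C| \<le>o |C|"
      by - (elim exE conjE, rule that, assumption+, rule bspec)
    show "n_le \<kappa> X E \<le>o n_le \<kappa> Y F"
      unfolding n_le_def
      by (rule card_of_filter_le[OF f(1,2)]) (rule ordLeq_transitive[OF f(3)])
  qed
  show "invariantly_embeddable X E Y F \<longleftrightarrow>
      (\<forall>\<kappa> :: ('k + 'a + 'b) rel. Card_order \<kappa> \<longrightarrow> n_eq \<kappa> X E \<le>o n_eq \<kappa> Y F)"
  proof (intro iffI allI impI)
    fix \<kappa> :: "('k + 'a + 'b) rel" assume "invariantly_embeddable X E Y F"
    from iffD1[OF invariantly_embeddable_iff_map[OF E F] this]
    obtain f where f: "inj_on f (X // E)" "f ` (X // E) \<subseteq> Y // F"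
        "\<And>C. C \<in> X // E \<Longrightarrow> |f C| =o |C|"
      by - (elim exE conjE, rule that, assumption+, rule bspec)
    show "n_eq \<kappa> X E \<le>o n_eq \<kappa> Y F"
      unfolding n_eq_def
      by (rule card_of_filter_le[OF f(1,2)]) (rule ordIso_transitive[OF f(3)])
  next
    assume *: "\<forall>\<kappa> :: ('k + 'a + 'b) rel. Card_order \<kappa> \<longrightarrow> n_eq \<kappa> X E \<le>o n_eq \<kappa> Y F"
    have le: "n_eq |C| X E \<le>o n_eq |C| Y F" for C :: "'a set"
      using exX[of C] * by (metis n_eq_cong)
    obtain f where "inj_on f (X // E)" "f ` (X // E) \<subseteq> Y // F"
        "\<And>C. C \<in> X // E \<Longrightarrow> |f C| =o |C|"
      by (rule glue_levels[of "X // E" card_of "Y // F" card_of,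
            OF le[unfolded n_eq_def] card_of_Card_order]) (auto intro: that)
    then show "invariantly_embeddable X E Y F"
      using invariantly_embeddable_iff_map[OF E F] by blast
  qed
  show "isomorphic X E Y F \<longleftrightarrow>
      (\<forall>\<kappa> :: ('k + 'a + 'b) rel. Card_order \<kappa> \<longrightarrow> n_eq \<kappa> X E =o n_eq \<kappa> Y F)"
  proof (intro iffI allI impI)
    fix \<kappa> :: "('k + 'a + 'b) rel" assume "isomorphic X E Y F"
    then obtain f where f: "bij_betw f (X // E) (Y // F)" "\<And>C. C \<in> X // E \<Longrightarrow> |f C| =o |C|"
      using isomorphic_iff_map[OF E F] by blast
    have "n_eq \<kappa> X E \<le>o n_eq \<kappa> Y F"
      unfolding n_eq_def
      by (rule card_of_filter_le[OF bij_betw_imp_inj_on[OF f(1)] bij_betw_imp_surj_on[OF f(1), THEN equalityD1]])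
        (rule ordIso_transitive[OF f(2)])
    moreover have "n_eq \<kappa> Y F \<le>o n_eq \<kappa> X E"
      unfolding n_eq_def
      by (rule card_of_filter_ge[OF f(1)]) (rule ordIso_transitive[OF ordIso_symmetric[OF f(2)]])
    ultimately show "n_eq \<kappa> X E =o n_eq \<kappa> Y F"
      by (simp add: ordIso_iff_ordLeq)
  next
    assume *: "\<forall>\<kappa> :: ('k + 'a + 'b) rel. Card_order \<kappa> \<longrightarrow> n_eq \<kappa> X E =o n_eq \<kappa> Y F"
    have eq: "n_eq |C| X E =o n_eq |C| Y F" for C :: "'a set"
      using exX[of C] * by (metis n_eq_cong)
    \<comment> \<open>The counts agree at every size occurring in \<open>E\<close>, so
      \<open>f\<close> covers all classes of \<open>F\<close> of such a size.\<close>
    obtain f where f: "inj_on f (X // E)" "f ` (X // E) \<subseteq> Y // F"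
        "\<And>C. C \<in> X // E \<Longrightarrow> |f C| =o |C|"
        "\<And>C D. C \<in> X // E \<Longrightarrow> D \<in> Y // F \<Longrightarrow> |D| =o |C| \<Longrightarrow> D \<in> f ` (X // E)"
      by (rule glue_levels[of "X // E" card_of "Y // F" card_of,
            OF ordIso_imp_ordLeq[OF eq[unfolded n_eq_def]] card_of_Card_order])
        (auto intro: that simp: eq[unfolded n_eq_def])
    \<comment> \<open>It remains to exclude sizes occurring only in \<open>F\<close>. At the size of
      \<open>D\<close> the count for \<open>F\<close> is nonzero, as \<open>D\<close> itself is
      counted, so \<open>E\<close> has a class of that size too.\<close>
    have "D \<in> f ` (X // E)" if D: "D \<in> Y // F" for D
    proof -
      have "n_eq |D| X E =o n_eq |D| Y F"
        using exY[of D] * by (metis n_eq_cong)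
      then have "|{C \<in> X // E. |C| =o |D| }| =o |{D' \<in> Y // F. |D'| =o |D| }|"
        by (simp add: n_eq_def)
      then have "|{D' \<in> Y // F. |D'| =o |D| }| =o |{C \<in> X // E. |C| =o |D| }|"
        by (rule ordIso_symmetric)
      moreover have "D \<in> {D' \<in> Y // F. |D'| =o |D| }"
        using D card_of_refl by blast
      ultimately have "{C \<in> X // E. |C| =o |D| } \<noteq> {}"
        using card_of_empty2 by force
      then show ?thesis
        using f(4) D ordIso_symmetric by blast
    qed
    then have "bij_betw f (X // E) (Y // F)"
      using f(1,2) by (auto simp: bij_betw_def)
    then show "isomorphic X E Y F"
      using f(3) isomorphic_iff_map[OF E F] by blast
  qed
  show "fully_embeddable X E Y F \<longleftrightarrow> surjectively_reducible Y F X E"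
  proof
    assume "fully_embeddable X E Y F"
    then obtain f where f: "bij_betw f (X // E) (Y // F)" "\<And>C. C \<in> X // E \<Longrightarrow> |C| \<le>o |f C|"
      using fully_embeddable_iff_map[OF E F] by blast
    \<comment> \<open>Passing to the inverse bijection turns the size comparison around.\<close>
    let ?g = "inv_into (X // E) f"
    have "bij_betw ?g (Y // F) (X // E)"
      using f(1) by (rule bij_betw_inv_into)
    moreover have "|?g D| \<le>o |D|" if "D \<in> Y // F" for D
      using that f by (metis bij_betw_imp_surj_on f_inv_into_f inv_into_into)
    ultimately show "surjectively_reducible Y F X E"
      using surjectively_reducible_iff_map[OF F E] by blast
  next
    assume "surjectively_reducible Y F X E"
    then obtain f where f: "bij_betw f (Y // F) (X // E)" "\<And>D. D \<in> Y // F \<Longrightarrow> |f D| \<le>o |D|"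
      using surjectively_reducible_iff_map[OF F E] by blast
    let ?g = "inv_into (Y // F) f"
    have "bij_betw ?g (X // E) (Y // F)"
      using f(1) by (rule bij_betw_inv_into)
    moreover have "|C| \<le>o |?g C|" if "C \<in> X // E" for C
      using that f by (metis bij_betw_imp_surj_on f_inv_into_f inv_into_into)
    ultimately show "fully_embeddable X E Y F"
      using fully_embeddable_iff_map[OF E F] by blast
  qed
qed

end
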